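(* Let $\lambda/\mu$ and $\nu/\rho$ be skew shapes such that the skew shape $(\lambda\vee\nu)/(\mu\wedge\rho)$ is connected. Then $$f(\lambda/\mu)\cdot f(\nu/\rho)\ =\ f\big((\lambda\vee\nu)/(\mu\vee\rho)\big)\cdot f\big((\lambda\wedge\nu)/(\mu\wedge\rho)\big)$$ if and only if either ($\lambda\subseteq\nu$ and $\mu\subseteq\rho$) or ($\nu\subseteq\lambda$ and $\rho\subseteq\mu$).
   Context: A partition is a sequence $\lambda=(\lambda_1\ge\lambda_2\ge\dots)$ of nonnegative integers with finitely many nonzero terms, identified with its Young diagram $\{(i,j): i\ge1,\ 1\le j\le\lambda_i\}$. Write $\mu\subseteq\lambda$ if $\mu_i\le\lambda_i$ for all $i$. A skew shape $\lambda/\mu$ is a pair of partitions with $\mu\subseteq\lambda$; its skew Young diagram is the set difference of the diagrams, and $|\lambda/\mu|$ is its number of squares. A skew shape is connected if its squares are rook-connected, i.e. any two squares are joined by a path of squares of the diagram in which consecutive squares share an edge. For partitions $\alpha,\beta$: $\alpha\vee\beta=(\max\{\alpha_i,\beta_i\})_i$ and $\alpha\wedge\beta=(\min\{\alpha_i,\beta_i\})_i$. A standard Young tableau of shape $\lambda/\mu$ with $|\lambda/\mu|=n$ is a bijection from the squares of $\lambda/\mu$ to $\{1,\dots,n\}$ that increases along rows and down columns; $\mathrm{SYT}(\lambda/\mu)$ is the set of these. Define $f(\lambda/\mu)=|\mathrm{SYT}(\lambda/\mu)|/n!$ where $n=|\lambda/\mu|$. *)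

theory Defs
  imports Complex_Main "HOL-Library.FuncSet"
begin

text \<open>
  Rows and columns are numbered from 0, so a partition $p_1 \ge p_2 \ge \dots$ is the function
  mapping \<open>i\<close> to $p_{i+1}$, and the square in row $i$ and column $j$ of the usual
  (1-based) diagram is \<open>(i - 1, j - 1)\<close>. On \<open>nat \<Rightarrow> nat\<close> the library's \<open>\<le>\<close>, \<open>sup\<close>
  and \<open>inf\<close> are pointwise; they are the containment \<open>\<subseteq>\<close>, the join \<open>\<or>\<close> and the
  meet \<open>\<and>\<close> of partitions.
\<close>

definition is_partition :: "(nat \<Rightarrow> nat) \<Rightarrow> bool" where
  "is_partition p \<longleftrightarrow> antimono p \<and> finite {i. p i \<noteq> 0}"

definition skew_shape :: "(nat \<Rightarrow> nat) \<Rightarrow> (nat \<Rightarrow> nat) \<Rightarrow> bool" where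
  "skew_shape p q \<longleftrightarrow> is_partition p \<and> is_partition q \<and> q \<le> p"

definition diagram :: "(nat \<Rightarrow> nat) \<Rightarrow> (nat \<times> nat) set" where
  "diagram p = {(i, j). j < p i}"

definition skew_diagram :: "(nat \<Rightarrow> nat) \<Rightarrow> (nat \<Rightarrow> nat) \<Rightarrow> (nat \<times> nat) set" where
  "skew_diagram p q = diagram p - diagram q"

definition share_edge :: "nat \<times> nat \<Rightarrow> nat \<times> nat \<Rightarrow> bool" where
  "share_edge s t \<longleftrightarrow>
     (fst s = fst t \<and> (snd t = Suc (snd s) \<or> snd s = Suc (snd t))) \<or>
     (snd s = snd t \<and> (fst t = Suc (fst s) \<or> fst s = Suc (fst t)))"

definition rook_connected :: "(nat \<times> nat) set \<Rightarrow> bool" where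
  "rook_connected D \<longleftrightarrow>
     (\<forall>s\<in>D. \<forall>t\<in>D. (s, t) \<in> {(u, v). u \<in> D \<and> v \<in> D \<and> share_edge u v}\<^sup>*)"

text \<open>
  A tableau is represented by a function that is \<open>undefined\<close> off the diagram, so that distinct
  elements of \<open>SYT p q\<close> are distinct fillings.
\<close>

definition SYT :: "(nat \<Rightarrow> nat) \<Rightarrow> (nat \<Rightarrow> nat) \<Rightarrow> (nat \<times> nat \<Rightarrow> nat) set" where
  "SYT p q = {T \<in> extensional (skew_diagram p q).
     bij_betw T (skew_diagram p q) {1..card (skew_diagram p q)} \<and>
     (\<forall>i j j'. (i, j) \<in> skew_diagram p q \<longrightarrow> (i, j') \<in> skew_diagram p q \<longrightarrow> j < j' \<longrightarrow>
        T (i, j) < T (i, j')) \<and>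
     (\<forall>i i' j. (i, j) \<in> skew_diagram p q \<longrightarrow> (i', j) \<in> skew_diagram p q \<longrightarrow> i < i' \<longrightarrow>
        T (i, j) < T (i', j))}"

definition syt_ratio :: "(nat \<Rightarrow> nat) \<Rightarrow> (nat \<Rightarrow> nat) \<Rightarrow> real" where
  "syt_ratio p q = real (card (SYT p q)) / fact (card (skew_diagram p q))"

lemma is_partition_sup: "is_partition p \<Longrightarrow> is_partition q \<Longrightarrow> is_partition (sup p q)"
proof -
  assume p: "is_partition p" and q: "is_partition q"
  have "{i. sup p q i \<noteq> 0} \<subseteq> {i. p i \<noteq> 0} \<union> {i. q i \<noteq> 0}"
    by (auto simp: sup_nat_def)
  moreover have "finite ({i. p i \<noteq> 0} \<union> {i. q i \<noteq> 0})"
    using p q by (simp add: is_partition_def)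
  moreover have "antimono (sup p q)"
    using p q by (auto simp: is_partition_def antimono_def le_fun_def intro: le_supI1 le_supI2)
  ultimately show ?thesis
    unfolding is_partition_def using finite_subset by blast
qed

lemma is_partition_inf: "is_partition p \<Longrightarrow> is_partition q \<Longrightarrow> is_partition (inf p q)"
proof -
  assume p: "is_partition p" and q: "is_partition q"
  have "{i. inf p q i \<noteq> 0} \<subseteq> {i. p i \<noteq> 0}"
    by (auto simp: inf_nat_def)
  moreover have "finite {i. p i \<noteq> 0}"
    using p by (simp add: is_partition_def)
  moreover have "antimono (inf p q)"
    using p q by (auto simp: is_partition_def antimono_def le_fun_def intro: le_infI1 le_infI2)
  ultimately show ?thesis
    unfolding is_partition_def using finite_subset by blast
qed

lemma finite_skew_diagram:
  assumes "is_partition p"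
  shows "finite (skew_diagram p q)"
proof -
  have "diagram p = (SIGMA i:{i. p i \<noteq> 0}. {..<p i})"
    by (auto simp: diagram_def)
  then show ?thesis
    using assms by (simp add: skew_diagram_def is_partition_def)
qed

lemma skew_shape_sup_inf:
  assumes "skew_shape l m" "skew_shape n r"
  shows "skew_shape (sup l n) (inf m r)" "skew_shape (sup l n) (sup m r)"
    "skew_shape (inf l n) (inf m r)"
  using assms
  by (auto simp: skew_shape_def is_partition_sup is_partition_inf
      intro: sup_mono inf_mono le_infI1 le_infI2 le_supI1 le_supI2)

end

theory Submission
  imports Defs "HOL-Library.Product_Order"
begin

text \<open>
  The statement is a strict form of log-supermodularity that holds in every poset. For a finite
  set \<open>S\<close> let \<open>f S\<close> be the number of linear extensions of \<open>S\<close> divided by \<open>(card S)!\<close>. With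
  \<open>L\<close>, \<open>M\<close>, \<open>N\<close>, \<open>R\<close> the diagrams of \<open>lam\<close>, \<open>mu\<close>, \<open>nu\<close>, \<open>rho\<close>, write \<open>X = L - M\<close>, \<open>Y = N - R\<close>,
  \<open>Z = (L \<union> N) - (M \<union> R)\<close> and \<open>W = (L \<inter> N) - (M \<inter> R)\<close>. The claim is \<open>f X * f Y \<le> f Z * f W\<close>,
  strictly when the two pairs are incomparable and the shape \<open>(L \<union> N) - (M \<inter> R)\<close> is connected.

  The engine is the recursion \<open>card S * f S = (\<Sum>c. f (S - {c}))\<close> over the maximal elements \<open>c\<close> of
  \<open>S\<close> (\<open>extension_ratio_rec\<close>). Since \<open>card X + card Y = card Z + card W = n\<close>, it expands both
  \<open>n * (f X * f Y)\<close> and \<open>n * (f Z * f W)\<close> into sums over single elements, which are compared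
  element by element using the inequality for smaller pairs. Deleting from \<open>L\<close> a maximal \<open>c\<close> of \<open>X\<close>
  deletes \<open>c\<close> from \<open>Z\<close> if \<open>c \<notin> N\<close>, and from \<open>W\<close> if \<open>c \<in> N\<close>. So the terms match, except for a
  \<open>c\<close> maximal in both \<open>X\<close> and \<open>Y\<close>: there the left side has two terms \<open>a\<close>, \<open>b\<close>, both at most the
  \<open>W\<close>-term \<open>w\<close>, while the right side has \<open>w\<close> and one \<open>Z\<close>-term. As in the proof of the four functions
  theorem, \<open>a + b \<le> w + a * b / w\<close>, because \<open>(w - a) * (w - b) \<ge> 0\<close>. The correction \<open>a * b / w\<close> is
  a multiple of \<open>f X * f Y\<close> itself, and the \<open>Z\<close>-term is at least the same multiple of \<open>f Z * f W\<close>.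
  Thus the unknown inequality enters linearly and can be solved for (\<open>weighted_sum_comparison\<close>).

  For strictness, call the pairs entangled if a point of \<open>(L - N) \<union> (M - R)\<close> is joined to a point of
  \<open>(N - L) \<union> (R - M)\<close> by a chain of comparabilities inside \<open>(L \<union> N) - (M \<inter> R)\<close>. Deleting
  from \<open>L\<close> a point that lies in \<open>N\<close> preserves entanglement. Moreover entangled pairs have nonempty
  \<open>W\<close> (\<open>entangled_imp_meet_nonempty\<close>). Take \<open>d\<close> maximal in \<open>W\<close>. If \<open>d\<close> is maximal in \<open>X\<close> or in
  \<open>Y\<close>, its comparison is strict by induction; otherwise \<open>d\<close> contributes a positive term on the right
  and nothing on the left. For a rook-connected shape, incomparable pairs are entangled, since
  squares sharing an edge are comparable.
\<close>

section \<open>Linear extensions of finite posets\<close>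

definition down_closed :: "'a::order set \<Rightarrow> bool" where
  "down_closed S \<longleftrightarrow> (\<forall>x\<in>S. \<forall>y\<le>x. y \<in> S)"

definition maximal_elements :: "'a::order set \<Rightarrow> 'a set" where
  "maximal_elements S = {c \<in> S. \<forall>y\<in>S. \<not> c < y}"

definition linear_extensions :: "'a::order set \<Rightarrow> ('a \<Rightarrow> nat) set" where
  "linear_extensions S = {T \<in> extensional S. bij_betw T S {1..card S} \<and>
     (\<forall>x\<in>S. \<forall>y\<in>S. x < y \<longrightarrow> T x < T y)}"

definition extension_ratio :: "'a::order set \<Rightarrow> real" where
  "extension_ratio S = real (card (linear_extensions S)) / fact (card S)"

lemma maximal_elements_subset: "maximal_elements S \<subseteq> S"
  by (auto simp: maximal_elements_def)

lemma finite_maximal_elements: "finite S \<Longrightarrow> finite (maximal_elements S)"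
  by (rule finite_subset[OF maximal_elements_subset])

lemma maximal_elements_nonempty:
  assumes "finite S" "S \<noteq> {}"
  shows "maximal_elements S \<noteq> {}"
proof -
  obtain m where "m \<in> S" "\<forall>b\<in>S. m \<le> b \<longrightarrow> m = b"
    using finite_has_maximal[OF assms] by blast
  then have "m \<in> maximal_elements S"
    by (auto simp: maximal_elements_def less_le)
  then show ?thesis by blast
qed

lemma linear_extensions_empty: "linear_extensions {} = {\<lambda>x. undefined}"
  by (auto simp: linear_extensions_def bij_betw_def)

lemma finite_linear_extensions:
  assumes "finite S"
  shows "finite (linear_extensions S)"
proof (rule finite_subset)
  show "linear_extensions S \<subseteq> (S \<rightarrow>\<^sub>E {1..card S})"
    by (auto simp: linear_extensions_def PiE_def bij_betw_def)
  show "finite (S \<rightarrow>\<^sub>E {1..card S})"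
    using assms by (intro finite_PiE) auto
qed

text \<open>
  The largest label of a linear extension sits on a maximal element, and erasing it leaves a linear
  extension of the remaining elements. This and the next lemma turn that into a recursion.
\<close>

lemma card_linear_extensions_top:
  assumes fin: "finite S" and c: "c \<in> maximal_elements S"
  shows "card {T \<in> linear_extensions S. T c = card S} = card (linear_extensions (S - {c}))"
proof -
  let ?n = "card S"
  let ?A = "{T \<in> linear_extensions S. T c = ?n}"
  let ?B = "linear_extensions (S - {c})"
  have cS: "c \<in> S" and cmax: "\<And>y. y \<in> S \<Longrightarrow> \<not> c < y"
    using c by (auto simp: maximal_elements_def)
  define k where "k = card (S - {c})"
  have n: "?n = Suc k"
    using fin cS unfolding k_def by (rule card.remove)
  have B: "?B = {U \<in> extensional (S - {c}). bij_betw U (S - {c}) {1..k} \<and>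
      (\<forall>x\<in>S - {c}. \<forall>y\<in>S - {c}. x < y \<longrightarrow> U x < U y)}"
    by (simp only: linear_extensions_def k_def)
  have down: "restrict T (S - {c}) \<in> ?B" if T: "T \<in> ?A" for T
  proof -
    have b: "bij_betw T S {1..?n}" and Tc: "T c = ?n"
      and mono: "\<And>x y. x \<in> S \<Longrightarrow> y \<in> S \<Longrightarrow> x < y \<Longrightarrow> T x < T y"
      using T by (auto simp: linear_extensions_def)
    have "bij_betw T (S - {c}) ({1..?n} - {?n})"
    proof (rule bij_betw_DiffI[OF b])
      show "bij_betw T {c} {?n}" using Tc by (simp add: bij_betw_def)
      show "{c} \<subseteq> S" "{?n} \<subseteq> {1..?n}" using cS n by auto
    qed
    moreover have "{1..?n} - {?n} = {1..k}"
      using n by auto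
    ultimately have "bij_betw T (S - {c}) {1..k}"
      by simp
    then have "bij_betw (restrict T (S - {c})) (S - {c}) {1..k}"
      by (rule bij_betw_cong[THEN iffD1, rotated]) auto
    then show ?thesis
      using mono by (auto simp: B)
  qed
  have up: "U(c := ?n) \<in> ?A" if U: "U \<in> ?B" for U
  proof -
    have b: "bij_betw U (S - {c}) {1..k}"
      and ext: "U \<in> extensional (S - {c})"
      and mono: "\<And>x y. x \<in> S - {c} \<Longrightarrow> y \<in> S - {c} \<Longrightarrow> x < y \<Longrightarrow> U x < U y"
      using U by (auto simp: B)
    have less: "U x < ?n" if "x \<in> S - {c}" for x
      using bspec[OF bij_betwE[OF b] that] n by simp
    have "bij_betw (U(c := ?n)) (S - {c}) {1..k}"
      using b by (rule bij_betw_cong[THEN iffD1, rotated]) auto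
    then have "bij_betw (U(c := ?n)) ((S - {c}) \<union> {c}) ({1..k} \<union> {(U(c := ?n)) c})"
      by (intro notIn_Un_bij_betw) (auto simp: n)
    moreover have "(S - {c}) \<union> {c} = S" "{1..k} \<union> {(U(c := ?n)) c} = {1..?n}"
      using cS n by auto
    ultimately have "bij_betw (U(c := ?n)) S {1..?n}"
      by simp
    moreover have "U(c := ?n) \<in> extensional S"
      using ext cS by (auto simp: extensional_def)
    moreover have "(U(c := ?n)) x < (U(c := ?n)) y" if "x \<in> S" "y \<in> S" "x < y" for x y
      using that mono[of x y] less[of x] cmax[of y] by (cases "x = c"; cases "y = c") auto
    ultimately show ?thesis
      by (auto simp: linear_extensions_def)
  qed
  have "bij_betw (\<lambda>T. restrict T (S - {c})) ?A ?B"
  proof (rule bij_betw_byWitness[where f' = "\<lambda>U. U(c := ?n)"])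
    show "\<forall>T\<in>?A. (restrict T (S - {c}))(c := ?n) = T"
      by (auto simp: linear_extensions_def extensional_def fun_eq_iff)
    show "\<forall>U\<in>?B. restrict (U(c := ?n)) (S - {c}) = U"
      by (auto simp: B extensional_def fun_eq_iff restrict_def)
    show "(\<lambda>T. restrict T (S - {c})) ` ?A \<subseteq> ?B"
      using down by blast
    show "(\<lambda>U. U(c := ?n)) ` ?B \<subseteq> ?A"
      using up by blast
  qed
  then show ?thesis
    by (rule bij_betw_same_card)
qed

lemma card_linear_extensions_rec:
  assumes fin: "finite S" and ne: "S \<noteq> {}"
  shows "card (linear_extensions S) =
           (\<Sum>c\<in>maximal_elements S. card (linear_extensions (S - {c})))"
proof -
  let ?P = "\<lambda>c. {T \<in> linear_extensions S. T c = card S}"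
  have pos: "card S \<in> {1..card S}"
    using fin ne by (simp add: Suc_le_eq card_gt_0_iff)
  have "linear_extensions S = (\<Union>c\<in>maximal_elements S. ?P c)"
  proof
    show "linear_extensions S \<subseteq> (\<Union>c\<in>maximal_elements S. ?P c)"
    proof
      fix T assume T: "T \<in> linear_extensions S"
      then have b: "bij_betw T S {1..card S}"
        and mono: "\<And>x y. x \<in> S \<Longrightarrow> y \<in> S \<Longrightarrow> x < y \<Longrightarrow> T x < T y"
        by (auto simp: linear_extensions_def)
      obtain c where c: "c \<in> S" "T c = card S"
        using bij_betw_imp_surj_on[OF b] pos by (metis imageE)
      have "\<not> c < y" if "y \<in> S" for y
        using mono[OF c(1) that] c(2) bij_betwE[OF b] that by fastforce
      then show "T \<in> (\<Union>c\<in>maximal_elements S. ?P c)"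
        using c T by (auto simp: maximal_elements_def)
    qed
  qed auto
  moreover have "card (\<Union>c\<in>maximal_elements S. ?P c) = (\<Sum>c\<in>maximal_elements S. card (?P c))"
  proof (rule card_UN_disjoint)
    show "finite (maximal_elements S)"
      using fin by (rule finite_maximal_elements)
    show "\<forall>c\<in>maximal_elements S. finite (?P c)"
      using finite_linear_extensions[OF fin] by auto
    show "\<forall>c\<in>maximal_elements S. \<forall>d\<in>maximal_elements S. c \<noteq> d \<longrightarrow> ?P c \<inter> ?P d = {}"
    proof (intro ballI impI)
      fix c d assume cd: "c \<in> maximal_elements S" "d \<in> maximal_elements S" "c \<noteq> d"
      have "T c \<noteq> T d" if "T \<in> linear_extensions S" for T
        using that cd maximal_elements_subset[of S]
        by (fastforce simp: linear_extensions_def bij_betw_def dest: inj_onD)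
      then show "?P c \<inter> ?P d = {}"
        by (intro equals0I) (metis (mono_tags, lifting) Int_iff mem_Collect_eq)
    qed
  qed
  ultimately show ?thesis
    using card_linear_extensions_top[OF fin] by simp
qed

lemma extension_ratio_empty [simp]: "extension_ratio {} = 1"
  by (simp add: extension_ratio_def linear_extensions_empty)

lemma extension_ratio_nonneg [simp]: "extension_ratio S \<ge> 0"
  by (simp add: extension_ratio_def)

lemma extension_ratio_rec:
  assumes fin: "finite S"
  shows "real (card S) * extension_ratio S = (\<Sum>c\<in>maximal_elements S. extension_ratio (S - {c}))"
proof (cases "S = {}")
  case True
  then show ?thesis by (simp add: maximal_elements_def)
next
  case False
  define k where "k = card S - 1"
  have k: "card S = Suc k"
    using False fin by (simp add: k_def card_gt_0_iff)
  have rem: "card (S - {c}) = k" if "c \<in> maximal_elements S" for c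
    using that maximal_elements_subset[of S] fin k by (simp add: subset_eq)
  have "real (card S) * extension_ratio S = real (card (linear_extensions S)) / fact k"
    by (simp add: extension_ratio_def k field_simps del: of_nat_Suc)
  also have "\<dots> = (\<Sum>c\<in>maximal_elements S. real (card (linear_extensions (S - {c}))) / fact k)"
    by (simp add: card_linear_extensions_rec[OF fin False] sum_divide_distrib)
  also have "\<dots> = (\<Sum>c\<in>maximal_elements S. extension_ratio (S - {c}))"
    by (intro sum.cong) (simp_all add: extension_ratio_def rem)
  finally show ?thesis .
qed

lemma extension_ratio_pos:
  assumes "finite S"
  shows "extension_ratio S > 0"
  using assms
proof (induction "card S" arbitrary: S rule: less_induct)
  case less
  show ?case
  proof (cases "S = {}")
    case False
    have "extension_ratio (S - {c}) > 0" if "c \<in> maximal_elements S" for c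
      using that maximal_elements_subset[of S] less.prems
      by (intro less.hyps psubset_card_mono) auto
    then have "(\<Sum>c\<in>maximal_elements S. extension_ratio (S - {c})) > 0"
      using maximal_elements_nonempty[OF less.prems False] finite_maximal_elements[OF less.prems]
      by (intro sum_pos) auto
    then show ?thesis
      using extension_ratio_rec[OF less.prems] False less.prems
      by (metis card_gt_0_iff of_nat_0_less_iff zero_less_mult_pos)
  qed simp
qed

section \<open>Entangled pairs of down-sets\<close>

definition comparable_in :: "'a::order set \<Rightarrow> ('a \<times> 'a) set" where
  "comparable_in D = {(u, v). u \<in> D \<and> v \<in> D \<and> (u \<le> v \<or> v \<le> u)}"

text \<open>
  Order pairs of down-sets by componentwise inclusion. A point of \<open>(L - N) \<union> (M - R)\<close> witnesses that
  \<open>(L, M)\<close> is not below \<open>(N, R)\<close>, and a point of \<open>(N - L) \<union> (R - M)\<close> witnesses the converse failure.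
  Pairs can be incomparable merely because they are ordered in opposite ways on two unrelated parts
  of the poset, and then equality persists; entanglement asks for opposite witnesses in the same
  connected part.
\<close>

definition entangled :: "'a::order set \<Rightarrow> 'a set \<Rightarrow> 'a set \<Rightarrow> 'a set \<Rightarrow> bool" where
  "entangled L M N R \<longleftrightarrow>
     (\<exists>x \<in> (L - N) \<union> (M - R). \<exists>y \<in> (N - L) \<union> (R - M).
        (x, y) \<in> (comparable_in ((L \<union> N) - (M \<inter> R)))\<^sup>*)"

lemma entangled_commute:
  assumes "entangled L M N R"
  shows "entangled N R L M"
proof -
  have "sym (comparable_in D)" for D :: "'a set"
    by (auto simp: comparable_in_def sym_def)
  then have "sym ((comparable_in D)\<^sup>*)" for D :: "'a set"
    by (rule sym_rtrancl)
  moreover have "(N \<union> L) - (R \<inter> M) = (L \<union> N) - (M \<inter> R)"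
    by blast
  ultimately show ?thesis
    using assms unfolding entangled_def by (metis symD)
qed

text \<open>
  A point of \<open>N\<close> stays in \<open>L \<union> N\<close> when it is deleted from \<open>L\<close>, so every connecting chain survives.
\<close>

lemma entangled_remove:
  assumes "entangled L M N R" "c \<in> N"
  shows "entangled (L - {c}) M N R"
proof -
  obtain x y where "x \<in> (L - N) \<union> (M - R)" "y \<in> (N - L) \<union> (R - M)"
      "(x, y) \<in> (comparable_in ((L \<union> N) - (M \<inter> R)))\<^sup>*"
    using assms(1) by (auto simp: entangled_def)
  moreover have "(L - {c}) \<union> N = L \<union> N"
    using assms(2) by blast
  moreover have "x \<in> ((L - {c}) - N) \<union> (M - R)" "y \<in> (N - (L - {c})) \<union> (R - M)"
    using calculation assms(2) by blast+
  ultimately show ?thesis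
    unfolding entangled_def by (intro bexI[of _ x] bexI[of _ y]) simp_all
qed

text \<open>
  If the meet shape is empty, then \<open>L \<inter> N = M \<inter> R\<close> and every point of \<open>(L \<union> N) - (M \<inter> R)\<close> is a
  witness of one of the two kinds. A chain joining both kinds would then contain two adjacent
  witnesses of different kinds, one in \<open>L - N\<close> and one in \<open>N - L\<close>; but points of \<open>L - N\<close> and
  \<open>N - L\<close> are incomparable, as both sets are down-closed.
\<close>

lemma entangled_imp_meet_nonempty:
  assumes down: "down_closed L" "down_closed M" "down_closed N" "down_closed R"
    and sub: "M \<subseteq> L" "R \<subseteq> N"
    and ent: "entangled L M N R"
  shows "(L \<inter> N) - (M \<inter> R) \<noteq> {}"
proof
  assume empty: "(L \<inter> N) - (M \<inter> R) = {}"
  let ?D = "(L \<union> N) - (M \<inter> R)"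
  let ?P = "(L - N) \<union> (M - R)"
  let ?Q = "(N - L) \<union> (R - M)"
  obtain x y where xy: "x \<in> ?P" "y \<in> ?Q" "(x, y) \<in> (comparable_in ?D)\<^sup>*"
    using ent by (auto simp: entangled_def)
  from xy(3) have "y \<in> ?P"
  proof (induction rule: rtrancl_induct)
    case base
    then show ?case using xy(1) .
  next
    case (step u v)
    have "v \<in> ?P \<or> v \<in> ?Q"
      using step.hyps(2) empty by (auto simp: comparable_in_def)
    moreover have "v \<notin> ?Q"
    proof
      assume "v \<in> ?Q"
      moreover have "u \<in> L - N" "v \<in> N - L"
        using step.IH calculation empty sub by auto
      moreover have "u \<le> v \<or> v \<le> u"
        using step.hyps(2) by (auto simp: comparable_in_def)
      ultimately show False
        using down(1,3) unfolding down_closed_def by blast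
    qed
    ultimately show ?case by blast
  qed
  then show False
    using xy(2) empty sub by auto
qed

section \<open>Two real inequalities\<close>

text \<open>
  Summing gives \<open>n * p \<le> S + p * T\<close> and \<open>S + q * T \<le> n * q\<close>, that is
  \<open>(n - T) * p \<le> S \<le> (n - T) * q\<close>. Positivity of \<open>S\<close> and \<open>q\<close> forces \<open>n - T > 0\<close>, so this factor
  can be cancelled.
\<close>

lemma weighted_sum_comparison:
  fixes lo hi s t :: "'b \<Rightarrow> real" and p q n :: real
  assumes fin: "finite U"
    and lo: "\<And>c. c \<in> U \<Longrightarrow> lo c \<le> s c + p * t c"
    and hi: "\<And>c. c \<in> U \<Longrightarrow> s c + q * t c \<le> hi c"
    and sums: "(\<Sum>c\<in>U. lo c) = n * p" "(\<Sum>c\<in>U. hi c) = n * q"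
    and pos: "(\<Sum>c\<in>U. s c) > 0" "q > 0"
  shows "p \<le> q"
    and "\<exists>c\<in>U. lo c < s c + p * t c \<or> s c + q * t c < hi c \<Longrightarrow> p < q"
proof -
  let ?S = "\<Sum>c\<in>U. s c" and ?T = "\<Sum>c\<in>U. t c"
  have p_sum: "(\<Sum>c\<in>U. s c + p * t c) = ?S + p * ?T"
    and q_sum: "(\<Sum>c\<in>U. s c + q * t c) = ?S + q * ?T"
    by (simp_all add: sum.distrib sum_distrib_left)
  have p_le: "n * p \<le> ?S + p * ?T"
    using sum_mono[of U lo "\<lambda>c. s c + p * t c"] lo sums(1) p_sum by simp
  have q_le: "?S + q * ?T \<le> n * q"
    using sum_mono[of U "\<lambda>c. s c + q * t c" hi] hi sums(2) q_sum by simp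
  have le: "(n - ?T) * p \<le> ?S" "?S \<le> (n - ?T) * q"
    using p_le q_le by (simp_all add: algebra_simps)
  have "0 < (n - ?T) * q"
    using le(2) pos(1) by linarith
  then have gap: "n - ?T > 0"
    using pos(2) by (simp add: zero_less_mult_iff)
  have "(n - ?T) * p \<le> (n - ?T) * q"
    using le by linarith
  then show "p \<le> q"
    using gap by (simp only: mult_le_cancel_left_pos)
  assume "\<exists>c\<in>U. lo c < s c + p * t c \<or> s c + q * t c < hi c"
  then have "n * p < ?S + p * ?T \<or> ?S + q * ?T < n * q"
    using sum_strict_mono_ex1[OF fin, of lo "\<lambda>c. s c + p * t c"]
      sum_strict_mono_ex1[OF fin, of "\<lambda>c. s c + q * t c" hi] lo hi sums p_sum q_sum
    by auto
  then have "(n - ?T) * p < (n - ?T) * q"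
    using le by (auto simp: algebra_simps)
  then show "p < q"
    using gap by (simp only: mult_less_cancel_left_pos)
qed

text \<open>
  The difference of the two sides is \<open>(c - a) * (c - b) / c\<close>.
\<close>

lemma sum_le_product_correction:
  fixes a b c :: real
  assumes "0 < c"
  shows "a \<le> c \<Longrightarrow> b \<le> c \<Longrightarrow> a + b \<le> c + a * b / c"
    and "a < c \<Longrightarrow> b < c \<Longrightarrow> a + b < c + a * b / c"
proof -
  have eq: "c + a * b / c - (a + b) = (c - a) * (c - b) / c"
    using assms by (simp add: field_simps)
  show "a + b \<le> c + a * b / c" if "a \<le> c" "b \<le> c"
  proof -
    have "0 \<le> (c - a) * (c - b) / c"
      using that assms by (intro divide_nonneg_pos mult_nonneg_nonneg) auto
    then show ?thesis using eq by linarith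
  qed
  show "a + b < c + a * b / c" if "a < c" "b < c"
  proof -
    have "0 < (c - a) * (c - b) / c"
      using that assms by (intro divide_pos_pos mult_pos_pos) auto
    then show ?thesis using eq by linarith
  qed
qed

section \<open>Strict log-supermodularity\<close>

definition nested_down_sets :: "'a::order set \<Rightarrow> 'a set \<Rightarrow> bool" where
  "nested_down_sets L M \<longleftrightarrow> finite L \<and> down_closed L \<and> down_closed M \<and> M \<subseteq> L"

lemma nested_down_sets_remove:
  assumes "nested_down_sets L M" "c \<in> maximal_elements (L - M)"
  shows "nested_down_sets (L - {c}) M"
  using assms unfolding nested_down_sets_def down_closed_def maximal_elements_def
  by (auto simp: less_le)

lemma card_join_meet:
  assumes "nested_down_sets L M" "nested_down_sets N R"
  shows "card (L - M) + card (N - R) = card ((L \<union> N) - (M \<union> R)) + card ((L \<inter> N) - (M \<inter> R))"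
proof -
  have fin: "finite L" "finite M" "finite N" "finite R" and sub: "M \<subseteq> L" "R \<subseteq> N"
    using assms by (auto simp: nested_down_sets_def intro: finite_subset)
  have split: "card (B - A) + card A = card B" if "finite B" "A \<subseteq> B" for A B :: "'a set"
    using that by (simp add: card_Diff_subset finite_subset card_mono)
  have "card (L - M) + card M = card L" "card (N - R) + card R = card N"
    "card ((L \<union> N) - (M \<union> R)) + card (M \<union> R) = card (L \<union> N)"
    "card ((L \<inter> N) - (M \<inter> R)) + card (M \<inter> R) = card (L \<inter> N)"
    using fin sub by (intro split; blast)+
  moreover have "card L + card N = card (L \<union> N) + card (L \<inter> N)"
    "card M + card R = card (M \<union> R) + card (M \<inter> R)"
    using fin by (intro card_Un_Int; simp)+
  ultimately show ?thesis by linarith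
qed

text \<open>
  Both claims are proved by one induction on \<open>card (L - M) + card (N - R)\<close>: strictness for entangled
  pairs rests on strictness for the smaller pairs.
\<close>

theorem extension_ratio_supermodular:
  fixes L M N R :: "'a::order set"
  assumes "nested_down_sets L M" "nested_down_sets N R"
  shows "extension_ratio (L - M) * extension_ratio (N - R) \<le>
           extension_ratio ((L \<union> N) - (M \<union> R)) * extension_ratio ((L \<inter> N) - (M \<inter> R)) \<and>
         (entangled L M N R \<longrightarrow>
           extension_ratio (L - M) * extension_ratio (N - R) <
           extension_ratio ((L \<union> N) - (M \<union> R)) * extension_ratio ((L \<inter> N) - (M \<inter> R)))"
  using assms
proof (induction "card (L - M) + card (N - R)" arbitrary: L N rule: less_induct)
  case less
  note LM = less.prems(1) and NR = less.prems(2)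
  have fin: "finite L" "finite N" and sub: "M \<subseteq> L" "R \<subseteq> N"
    and down: "down_closed L" "down_closed M" "down_closed N" "down_closed R"
    using LM NR by (auto simp: nested_down_sets_def)
  let ?f = "extension_ratio :: 'a set \<Rightarrow> real"
  let ?X = "L - M" and ?Y = "N - R"
  let ?Z = "(L \<union> N) - (M \<union> R)" and ?W = "(L \<inter> N) - (M \<inter> R)"
  let ?mX = "maximal_elements ?X" and ?mY = "maximal_elements ?Y"
  let ?mZ = "maximal_elements ?Z" and ?mW = "maximal_elements ?W"
  define p where "p = ?f ?X * ?f ?Y"
  define q where "q = ?f ?Z * ?f ?W"
  have posf: "?f S > 0" if "S \<subseteq> L \<union> N" for S
    using that fin by (intro extension_ratio_pos) (auto intro: finite_subset)
  have q0: "q > 0"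
    unfolding q_def by (intro mult_pos_pos posf) auto
  have mX_eq: "(L - {c}) - M = ?X - {c}" for c by blast
  have mY_eq: "(N - {c}) - R = ?Y - {c}" for c by blast
  have card_lt: "card (S - {c}) < card S" if "c \<in> maximal_elements S" "S \<subseteq> L \<union> N" for S c
    using that maximal_elements_subset[of S] fin
    by (intro psubset_card_mono) (auto intro: finite_subset)

  \<comment> \<open>How a maximal element of \<open>X\<close> or \<open>Y\<close> reappears as a maximal element of \<open>Z\<close> or \<open>W\<close>.\<close>
  have mX_outside: "c \<in> ?mZ" if "c \<in> ?mX" "c \<notin> N" for c
    using that sub down unfolding maximal_elements_def down_closed_def
    by (auto intro: less_imp_le)
  have mY_outside: "c \<in> ?mZ" if "c \<in> ?mY" "c \<notin> L" for c
    using that sub down unfolding maximal_elements_def down_closed_def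
    by (auto intro: less_imp_le)
  have mX_inside: "c \<in> ?mW" if "c \<in> ?mX" "c \<in> N" for c
    using that down unfolding maximal_elements_def down_closed_def
    by (auto intro: less_imp_le)
  have mY_inside: "c \<in> ?mW" if "c \<in> ?mY" "c \<in> L" for c
    using that down unfolding maximal_elements_def down_closed_def
    by (auto intro: less_imp_le)
  have m_common: "c \<in> ?mZ" if "c \<in> ?mX" "c \<in> ?mY" for c
    using that unfolding maximal_elements_def by auto

  \<comment> \<open>The induction hypothesis after deleting a maximal element; entanglement is carried along in the
    steps that delete the element from \<open>W\<close> and not from \<open>Z\<close>.\<close>
  have IH_X_out: "?f (?X - {c}) * ?f ?Y \<le> ?f (?Z - {c}) * ?f ?W" if c: "c \<in> ?mX" "c \<notin> N" for c
  proof -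
    have "(L - {c}) \<union> N - (M \<union> R) = ?Z - {c}" "(L - {c}) \<inter> N - (M \<inter> R) = ?W"
      using c by blast+
    then show ?thesis
      using less.hyps[of "L - {c}" N] nested_down_sets_remove[OF LM c(1)] NR card_lt[OF c(1)]
      by (simp add: mX_eq) blast
  qed
  have IH_Y_out: "?f ?X * ?f (?Y - {c}) \<le> ?f (?Z - {c}) * ?f ?W" if c: "c \<in> ?mY" "c \<notin> L" for c
  proof -
    have "L \<union> (N - {c}) - (M \<union> R) = ?Z - {c}" "L \<inter> (N - {c}) - (M \<inter> R) = ?W"
      using c by blast+
    then show ?thesis
      using less.hyps[of L "N - {c}"] nested_down_sets_remove[OF NR c(1)] LM card_lt[OF c(1)]
      by (simp add: mY_eq) blast
  qed
  have IH_X_in: "?f (?X - {c}) * ?f ?Y \<le> ?f ?Z * ?f (?W - {c}) \<and>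
      (entangled L M N R \<longrightarrow> ?f (?X - {c}) * ?f ?Y < ?f ?Z * ?f (?W - {c}))"
    if c: "c \<in> ?mX" "c \<in> N" for c
  proof -
    have "(L - {c}) \<union> N - (M \<union> R) = ?Z" "(L - {c}) \<inter> N - (M \<inter> R) = ?W - {c}"
      using c by blast+
    moreover have "card ((L - {c}) - M) + card ?Y < card ?X + card ?Y"
      using card_lt[OF c(1)] by (simp add: mX_eq) blast
    ultimately show ?thesis
      using less.hyps[of "L - {c}" N] nested_down_sets_remove[OF LM c(1)] NR
        entangled_remove[OF _ c(2), where L = L and M = M and R = R]
      by (simp add: mX_eq)
  qed
  have IH_Y_in: "?f ?X * ?f (?Y - {c}) \<le> ?f ?Z * ?f (?W - {c}) \<and>
      (entangled L M N R \<longrightarrow> ?f ?X * ?f (?Y - {c}) < ?f ?Z * ?f (?W - {c}))"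
    if c: "c \<in> ?mY" "c \<in> L" for c
  proof -
    have "L \<union> (N - {c}) - (M \<union> R) = ?Z" "L \<inter> (N - {c}) - (M \<inter> R) = ?W - {c}"
      using c by blast+
    moreover have "card ?X + card ((N - {c}) - R) < card ?X + card ?Y"
      using card_lt[OF c(1)] by (simp add: mY_eq) blast
    moreover have "entangled L M N R \<Longrightarrow> entangled L M (N - {c}) R"
      using entangled_commute entangled_remove[OF _ c(2)] by blast
    ultimately show ?thesis
      using less.hyps[of L "N - {c}"] nested_down_sets_remove[OF NR c(1)] LM
      by (simp add: mY_eq)
  qed
  have IH_common: "?f (?X - {c}) * ?f (?Y - {c}) \<le> ?f (?Z - {c}) * ?f (?W - {c})"
    if c: "c \<in> ?mX" "c \<in> ?mY" for c
  proof -
    have "(L - {c}) \<union> (N - {c}) - (M \<union> R) = ?Z - {c}"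
      "(L - {c}) \<inter> (N - {c}) - (M \<inter> R) = ?W - {c}"
      by blast+
    moreover have "card ((L - {c}) - M) + card ((N - {c}) - R) < card ?X + card ?Y"
      unfolding mX_eq mY_eq by (intro add_strict_mono card_lt c) auto
    ultimately show ?thesis
      using less.hyps[of "L - {c}" "N - {c}"] nested_down_sets_remove[OF LM c(1)]
        nested_down_sets_remove[OF NR c(2)]
      by (simp add: mX_eq mY_eq)
  qed

  \<comment> \<open>\<open>lo\<close> and \<open>hi\<close> collect the terms belonging to one element in the expansions of
    \<open>n * p\<close> and \<open>n * q\<close>.\<close>
  define lo where "lo c = (if c \<in> ?mX then ?f (?X - {c}) * ?f ?Y else 0) +
                          (if c \<in> ?mY then ?f ?X * ?f (?Y - {c}) else 0)" for c
  define hi where "hi c = (if c \<in> ?mZ then ?f (?Z - {c}) * ?f ?W else 0) +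
                          (if c \<in> ?mW then ?f ?Z * ?f (?W - {c}) else 0)" for c
  \<comment> \<open>For \<open>c\<close> maximal in both \<open>X\<close> and \<open>Y\<close>, the correction in \<open>a + b \<le> w + a * b / w\<close> equals \<open>p * t c\<close>,
    since \<open>a * b = p * (f (X - {c}) * f (Y - {c}))\<close>.\<close>
  define s where "s c = (if c \<in> ?mX \<inter> ?mY then ?f ?Z * ?f (?W - {c}) else lo c)" for c
  define t where "t c = (if c \<in> ?mX \<inter> ?mY
      then ?f (?X - {c}) * ?f (?Y - {c}) / (?f ?Z * ?f (?W - {c})) else 0)" for c
  have s_t_common: "s c = ?f ?Z * ?f (?W - {c})"
      "t c = ?f (?X - {c}) * ?f (?Y - {c}) / (?f ?Z * ?f (?W - {c}))"
    if "c \<in> ?mX \<inter> ?mY" for c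
    using that by (simp_all only: s_def t_def if_True)
  have s_t_other: "s c = lo c" "t c = 0" if "c \<notin> ?mX \<inter> ?mY" for c
    using that by (simp_all only: s_def t_def if_False)
  let ?U = "L \<union> N"
  have finU: "finite ?U" using fin by simp
  have sum_if: "(\<Sum>c\<in>?U. if c \<in> maximal_elements S then h c else 0) =
      (\<Sum>c\<in>maximal_elements S. h c)" if "S \<subseteq> ?U" for S and h :: "'a \<Rightarrow> real"
    using finU that maximal_elements_subset[of S]
    by (simp add: sum.If_cases Int_absorb1 subset_trans)
  have rec: "(\<Sum>c\<in>maximal_elements S. ?f (S - {c})) = real (card S) * ?f S" if "S \<subseteq> ?U" for S
    using extension_ratio_rec[of S] finite_subset[OF that finU] by simp
  have sum_lo: "(\<Sum>c\<in>?U. lo c) = real (card ?X + card ?Y) * p"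
  proof -
    have "(\<Sum>c\<in>?U. lo c) =
        (\<Sum>c\<in>?mX. ?f (?X - {c})) * ?f ?Y + ?f ?X * (\<Sum>c\<in>?mY. ?f (?Y - {c}))"
      unfolding lo_def sum.distrib
      by (subst sum_if, blast)+ (simp add: sum_distrib_left sum_distrib_right)
    also have "\<dots> = real (card ?X + card ?Y) * p"
      by (subst rec, blast)+ (simp add: p_def algebra_simps)
    finally show ?thesis .
  qed
  have sum_hi: "(\<Sum>c\<in>?U. hi c) = real (card ?X + card ?Y) * q"
  proof -
    have "(\<Sum>c\<in>?U. hi c) =
        (\<Sum>c\<in>?mZ. ?f (?Z - {c})) * ?f ?W + ?f ?Z * (\<Sum>c\<in>?mW. ?f (?W - {c}))"
      unfolding hi_def sum.distrib
      by (subst sum_if, blast)+ (simp add: sum_distrib_left sum_distrib_right)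
    also have "\<dots> = real (card ?Z + card ?W) * q"
      by (subst rec, blast)+ (simp add: q_def algebra_simps)
    also have "\<dots> = real (card ?X + card ?Y) * q"
      by (simp only: card_join_meet[OF LM NR])
    finally show ?thesis .
  qed

  have fp: "?f ?X > 0" "?f ?Y > 0" "?f ?Z > 0" "?f ?W > 0"
    "?f (?X - {c}) > 0" "?f (?Y - {c}) > 0" "?f (?Z - {c}) > 0" "?f (?W - {c}) > 0" for c
    by (intro posf; blast)+
  have lo_nonneg: "lo c \<ge> 0" for c
    by (simp add: lo_def)
  have lo_pos: "lo c > 0" if "c \<in> ?mX \<union> ?mY" for c
    using that fp by (auto simp: lo_def add_pos_nonneg add_nonneg_pos)
  have W_le_hi: "?f ?Z * ?f (?W - {c}) \<le> hi c" if "c \<in> ?mW" for c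
    using that by (simp add: hi_def)
  have Z_le_hi: "?f (?Z - {c}) * ?f ?W \<le> hi c" if "c \<in> ?mZ" for c
    using that by (simp add: hi_def)

  have lo_le: "lo c \<le> s c + p * t c" for c
  proof (cases "c \<in> ?mX \<inter> ?mY")
    case True
    then have "c \<in> L" "c \<in> N" using maximal_elements_subset by blast+
    let ?a = "?f (?X - {c}) * ?f ?Y" and ?b = "?f ?X * ?f (?Y - {c})"
    let ?c = "?f ?Z * ?f (?W - {c})"
    have "?a + ?b \<le> ?c + ?a * ?b / ?c"
      using IH_X_in[of c] IH_Y_in[of c] True \<open>c \<in> L\<close> \<open>c \<in> N\<close> fp
      by (intro sum_le_product_correction) auto
    then show ?thesis
      using True by (simp add: lo_def s_t_common p_def mult_ac)
  next
    case False
    then show ?thesis by (simp add: s_t_other)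
  qed
  have le_hi: "s c + q * t c \<le> hi c" for c
  proof (cases "c \<in> ?mX \<inter> ?mY")
    case True
    then have cLN: "c \<in> L" "c \<in> N" using maximal_elements_subset by blast+
    have "q * (?f (?X - {c}) * ?f (?Y - {c})) \<le> q * (?f (?Z - {c}) * ?f (?W - {c}))"
      using IH_common[of c] True q0 by (intro mult_left_mono) auto
    then have "q * t c \<le> q * (?f (?Z - {c}) * ?f (?W - {c})) / (?f ?Z * ?f (?W - {c}))"
      unfolding s_t_common(2)[OF True] times_divide_eq_right
      by (rule divide_right_mono) simp
    also have "\<dots> = ?f (?Z - {c}) * ?f ?W"
      by (simp add: q_def fp[THEN less_imp_neq, THEN not_sym])
    finally show ?thesis
      using True m_common[of c] mX_inside[of c] cLN by (simp add: s_t_common hi_def)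
  next
    case False
    have "lo c \<le> hi c"
    proof (cases "c \<in> ?mX")
      case X: True
      then have "lo c = ?f (?X - {c}) * ?f ?Y" using False by (simp add: lo_def)
      then show ?thesis
        using X IH_X_in[of c] IH_X_out[of c] W_le_hi[of c] Z_le_hi[of c] mX_inside[of c]
          mX_outside[of c]
        by (cases "c \<in> N") force+
    next
      case X: False
      show ?thesis
      proof (cases "c \<in> ?mY")
        case Y: True
        then have "lo c = ?f ?X * ?f (?Y - {c})" using X by (simp add: lo_def)
        then show ?thesis
          using Y IH_Y_in[of c] IH_Y_out[of c] W_le_hi[of c] Z_le_hi[of c] mY_inside[of c]
            mY_outside[of c]
          by (cases "c \<in> L") force+
      next
        case False
        then have "lo c = 0" using X by (simp add: lo_def)
        then show ?thesis
          by (simp add: hi_def)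
      qed
    qed
    then show ?thesis using s_t_other[OF False] by simp
  qed

  show ?case
  proof (cases "?X = {} \<and> ?Y = {}")
    case True
    then have "L = M" "N = R" using sub by auto
    then have "\<not> entangled L M N R"
      using entangled_imp_meet_nonempty[OF down sub] by auto
    then show ?thesis using \<open>L = M\<close> \<open>N = R\<close> by simp
  next
    case False
    then have "?mX \<union> ?mY \<noteq> {}"
      using maximal_elements_nonempty[of ?X] maximal_elements_nonempty[of ?Y] fin by auto
    then obtain c where c: "c \<in> ?mX \<union> ?mY" by blast
    have "s c > 0"
      using lo_pos[OF c] fp by (simp add: s_def)
    moreover have "c \<in> ?U"
      using c maximal_elements_subset by blast
    moreover have "s d \<ge> 0" for d
      using lo_nonneg[of d] fp by (simp add: s_def)
    ultimately have "(\<Sum>c\<in>?U. s c) > 0"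
      using finU by (intro sum_pos2) auto
    note comparison = weighted_sum_comparison[OF finU lo_le le_hi sum_lo sum_hi this q0]
    have "p < q" if ent: "entangled L M N R"
    proof (rule comparison(2))
      \<comment> \<open>Any maximal element of \<open>W\<close> gives a strict comparison.\<close>
      have "?W \<noteq> {}"
        by (rule entangled_imp_meet_nonempty[OF down sub ent])
      then obtain d where d: "d \<in> ?mW"
        using maximal_elements_nonempty[of ?W] fin by auto
      then have dLN: "d \<in> L" "d \<in> N" using maximal_elements_subset by blast+
      show "\<exists>c\<in>?U. lo c < s c + p * t c \<or> s c + q * t c < hi c"
      proof (rule bexI[of _ d])
        show "lo d < s d + p * t d \<or> s d + q * t d < hi d"
        proof (cases "d \<in> ?mX \<inter> ?mY")
          case True
          let ?a = "?f (?X - {d}) * ?f ?Y" and ?b = "?f ?X * ?f (?Y - {d})"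
          let ?c = "?f ?Z * ?f (?W - {d})"
          have "?a + ?b < ?c + ?a * ?b / ?c"
            using IH_X_in[of d] IH_Y_in[of d] True dLN ent fp
            by (intro sum_le_product_correction) auto
          then show ?thesis
            using True by (simp add: lo_def s_t_common p_def mult_ac)
        next
          case False
          then have "lo d < ?f ?Z * ?f (?W - {d})"
            using IH_X_in[of d] IH_Y_in[of d] dLN ent fp by (auto simp: lo_def)
          then show ?thesis
            using s_t_other[OF False] W_le_hi[OF d] by simp
        qed
        show "d \<in> ?U" using dLN by blast
      qed
    qed
    then show ?thesis
      using comparison(1) by (simp add: p_def q_def)
  qed
qed

section \<open>Skew shapes\<close>

lemma down_closed_diagram:
  assumes "is_partition p"
  shows "down_closed (diagram p)"
  using assms
  by (fastforce simp: down_closed_def diagram_def is_partition_def antimono_def less_eq_prod_def)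

lemma nested_down_sets_diagram:
  assumes "skew_shape p q"
  shows "nested_down_sets (diagram p) (diagram q)"
proof -
  have "finite (diagram p)"
    using finite_skew_diagram[of p "\<lambda>_. 0"] assms
    by (simp add: skew_shape_def skew_diagram_def diagram_def)
  then show ?thesis
    using assms down_closed_diagram
    by (auto simp: nested_down_sets_def skew_shape_def diagram_def le_fun_def intro: less_le_trans)
qed

text \<open>
  Increase along rows and columns gives increase along the whole product order: two comparable squares
  \<open>(i, j) \<le> (i', j')\<close> of a skew diagram have the square \<open>(i, j')\<close> of the diagram between them.
\<close>

lemma SYT_eq_linear_extensions:
  assumes "skew_shape p q"
  shows "SYT p q = linear_extensions (skew_diagram p q)"
proof -
  let ?D = "skew_diagram p q"
  have p: "is_partition p" and q: "is_partition q"
    using assms by (auto simp: skew_shape_def)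
  have corner: "(i, j') \<in> ?D" if "(i, j) \<in> ?D" "(i', j') \<in> ?D" "i \<le> i'" "j \<le> j'" for i j i' j'
    using that antimonoD[of p i i'] p by (auto simp: skew_diagram_def diagram_def is_partition_def)
  have "(\<forall>x\<in>?D. \<forall>y\<in>?D. x < y \<longrightarrow> T x < T y) \<longleftrightarrow>
     (\<forall>i j j'. (i, j) \<in> ?D \<longrightarrow> (i, j') \<in> ?D \<longrightarrow> j < j' \<longrightarrow> T (i, j) < T (i, j')) \<and>
     (\<forall>i i' j. (i, j) \<in> ?D \<longrightarrow> (i', j) \<in> ?D \<longrightarrow> i < i' \<longrightarrow> T (i, j) < T (i', j))"
    (is "?lhs \<longleftrightarrow> ?row \<and> ?col") for T :: "nat \<times> nat \<Rightarrow> nat"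
  proof
    assume ?lhs
    then show "?row \<and> ?col"
      by (auto simp: less_prod_def less_eq_prod_def)
  next
    assume rc: "?row \<and> ?col"
    show ?lhs
    proof (intro ballI impI)
      fix x y assume xy: "x \<in> ?D" "y \<in> ?D" "x < y"
      obtain i j i' j' where eq: "x = (i, j)" "y = (i', j')"
        by (cases x; cases y)
      have le: "i \<le> i'" "j \<le> j'" and ne: "i < i' \<or> j < j'"
        using xy(3) by (auto simp: eq less_prod_def less_eq_prod_def)
      have mid: "(i, j') \<in> ?D"
        using xy(1,2) le unfolding eq by (rule corner)
      have "j = j' \<or> T (i, j) < T (i, j')" "i = i' \<or> T (i, j') < T (i', j')"
        using rc mid xy le by (auto simp: eq le_less)
      then show "T x < T y"
        using ne by (auto simp: eq)
    qed
  qed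
  then show ?thesis
    unfolding SYT_def linear_extensions_def by auto
qed

lemma syt_ratio_eq_extension_ratio:
  assumes "skew_shape p q"
  shows "syt_ratio p q = extension_ratio (diagram p - diagram q)"
  using SYT_eq_linear_extensions[OF assms]
  by (simp add: syt_ratio_def extension_ratio_def skew_diagram_def)

lemma diagram_sup: "diagram (sup p q) = diagram p \<union> diagram q"
  and diagram_inf: "diagram (inf p q) = diagram p \<inter> diagram q"
  by (auto simp: diagram_def sup_nat_def inf_nat_def)

lemma diagram_subset_iff: "diagram p \<subseteq> diagram q \<longleftrightarrow> p \<le> q"
proof
  assume "diagram p \<subseteq> diagram q"
  then have "\<And>i j. j < p i \<Longrightarrow> j < q i"
    by (auto simp: diagram_def)
  then show "p \<le> q"
    by (metis le_funI not_le order_less_irrefl)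
qed (auto simp: diagram_def le_fun_def intro: less_le_trans)

lemma rook_connected_imp_comparable:
  assumes "rook_connected D" "x \<in> D" "y \<in> D"
  shows "(x, y) \<in> (comparable_in D)\<^sup>*"
proof -
  have "{(u, v). u \<in> D \<and> v \<in> D \<and> share_edge u v} \<subseteq> comparable_in D"
    by (auto simp: comparable_in_def share_edge_def less_eq_prod_def)
  moreover have "(x, y) \<in> {(u, v). u \<in> D \<and> v \<in> D \<and> share_edge u v}\<^sup>*"
    using assms unfolding rook_connected_def by blast
  ultimately show ?thesis
    using rtrancl_mono by blast
qed

theorem theorem4p2:
  fixes lam mu nu rho :: "nat \<Rightarrow> nat"
  assumes "skew_shape lam mu" and "skew_shape nu rho"
    and "rook_connected (skew_diagram (sup lam nu) (inf mu rho))"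
  shows "syt_ratio lam mu * syt_ratio nu rho =
           syt_ratio (sup lam nu) (sup mu rho) * syt_ratio (inf lam nu) (inf mu rho)
         \<longleftrightarrow> (lam \<le> nu \<and> mu \<le> rho) \<or> (nu \<le> lam \<and> rho \<le> mu)"
    (is "?eq \<longleftrightarrow> ?comp")
proof
  assume ?comp
  then show ?eq
    by (auto simp: sup_absorb1 sup_absorb2 inf_absorb1 inf_absorb2)
next
  assume eq: ?eq
  let ?L = "diagram lam" and ?M = "diagram mu" and ?N = "diagram nu" and ?R = "diagram rho"
  note LM = nested_down_sets_diagram[OF assms(1)] and NR = nested_down_sets_diagram[OF assms(2)]
  have "\<not> entangled ?L ?M ?N ?R"
    using extension_ratio_supermodular[OF LM NR] eq
    by (simp add: syt_ratio_eq_extension_ratio assms skew_shape_sup_inf diagram_sup diagram_inf)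
  moreover have "entangled ?L ?M ?N ?R" if "\<not> ?comp"
  proof -
    obtain x y where x: "x \<in> (?L - ?N) \<union> (?M - ?R)" and y: "y \<in> (?N - ?L) \<union> (?R - ?M)"
      using \<open>\<not> ?comp\<close> unfolding diagram_subset_iff[symmetric] by blast
    have "?M \<subseteq> ?L" "?R \<subseteq> ?N"
      using LM NR by (auto simp: nested_down_sets_def)
    then have "x \<in> (?L \<union> ?N) - (?M \<inter> ?R)" "y \<in> (?L \<union> ?N) - (?M \<inter> ?R)"
      using x y by blast+
    then have "(x, y) \<in> (comparable_in ((?L \<union> ?N) - (?M \<inter> ?R)))\<^sup>*"
      using rook_connected_imp_comparable[OF assms(3)]
      by (simp only: skew_diagram_def diagram_sup diagram_inf)
    then show ?thesis
      unfolding entangled_def using x y by (intro bexI)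
  qed
  ultimately show ?comp by blast
qed

end
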